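(* Fix an integer $l \geq 1$. There exist a real constant $\alpha$ (depending only on $l$), a polynomial $p$ (which may depend on $l$), and a deterministic algorithm such that the following holds. Let $k \geq 1$ and let $F$ be a monotone linear CNF formula that is $k$-uniform and $l$-regular, and such that each clause $C \in F$ is unconnected to exactly $l(l-2)$ other clauses of $F$. Then, given $F$, the algorithm decides whether $F$ is x-sat in at most $p(n)\exp\left(\alpha \ln(n)\sqrt{n}\right)$ steps, where $n = |V(F)|$.
   Context: A monotone CNF formula $F$ is a finite non-empty set (conjunction) of clauses in which every clause is a finite non-empty set (disjunction) of positive literals, i.e. of (unnegated) Boolean variables. $V(C)$ is the set of variables occurring in the clause $C$, and $V(F)$ the set of variables occurring in $F$. $F$ is linear if any two distinct clauses $C, C' \in F$ satisfy $|V(C) \cap V(C')| \leq 1$. Two clauses $C, C'$ are unconnected if they have no variable in common, i.e. $V(C) \cap V(C') = \emptyset$. $F$ is $k$-uniform if every clause of $F$ contains exactly $k$ literals, and $l$-regular if every variable $x \in V(F)$ occurs in exactly $l$ clauses of $F$. $F$ is x-sat if there is a truth assignment $V(F) \to \{0,1\}$ under which exactly one literal in each clause of $F$ is true. *)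

theory Defs
  imports Complex_Main "HOL-Computational_Algebra.Polynomial"
begin

section \<open>Monotone CNF formulas\<close>

text \<open>
  All literals are positive, so a clause is identified with the set of its variables; in
  particular \<open>V(C) = C\<close>. Every finite formula can be written over the variable names
  \<^typ>\<open>nat\<close>, which need not form an initial segment.
\<close>

type_synonym clause = "nat set"
type_synonym cnf = "clause set"

definition vars :: "cnf \<Rightarrow> nat set" where
  "vars F = \<Union>F"

definition monotone_cnf :: "cnf \<Rightarrow> bool" where
  "monotone_cnf F \<longleftrightarrow> finite F \<and> F \<noteq> {} \<and> (\<forall>C\<in>F. finite C \<and> C \<noteq> {})"

definition linear_cnf :: "cnf \<Rightarrow> bool" where
  "linear_cnf F \<longleftrightarrow> (\<forall>C\<in>F. \<forall>C'\<in>F. C \<noteq> C' \<longrightarrow> card (C \<inter> C') \<le> 1)"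

definition unconnected :: "clause \<Rightarrow> clause \<Rightarrow> bool" where
  "unconnected C C' \<longleftrightarrow> C \<inter> C' = {}"

definition uniform_cnf :: "nat \<Rightarrow> cnf \<Rightarrow> bool" where
  "uniform_cnf k F \<longleftrightarrow> (\<forall>C\<in>F. card C = k)"

definition regular_cnf :: "nat \<Rightarrow> cnf \<Rightarrow> bool" where
  "regular_cnf l F \<longleftrightarrow> (\<forall>x\<in>vars F. card {C \<in> F. x \<in> C} = l)"

definition xsat :: "cnf \<Rightarrow> bool" where
  "xsat F \<longleftrightarrow> (\<exists>\<tau> :: nat \<Rightarrow> bool. \<forall>C\<in>F. card {x \<in> C. \<tau> x} = 1)"


section \<open>Random access machines\<close>

text \<open>
  The machine has registers, addressed directly by the (finite) program, and an unbounded memory,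
  addressed indirectly through registers. Each instruction counts as one step. As there
  is no multiplication and no bit operation, this unit-cost measure is
  polynomially related to Turing machine time.
\<close>

type_synonym reg = nat
type_synonym label = nat

datatype instr =
    Const reg nat
  | Move reg reg
  | Add reg reg reg
  | Sub reg reg reg
  | Load reg reg
  | Store reg reg
  | Jump label
  | JumpZero reg label

type_synonym program = "instr list"

text \<open>A configuration consists of the program counter, the registers and the memory.\<close>

type_synonym config = "nat \<times> (reg \<Rightarrow> nat) \<times> (nat \<Rightarrow> nat)"

text \<open>Subtraction is truncated at zero.\<close>

fun exec :: "instr \<Rightarrow> config \<Rightarrow> config" where
  "exec (Const d c) (pc, R, M) = (Suc pc, R(d := c), M)"
| "exec (Move d a) (pc, R, M) = (Suc pc, R(d := R a), M)"
| "exec (Add d a b) (pc, R, M) = (Suc pc, R(d := R a + R b), M)"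
| "exec (Sub d a b) (pc, R, M) = (Suc pc, R(d := R a - R b), M)"
| "exec (Load d a) (pc, R, M) = (Suc pc, R(d := M (R a)), M)"
| "exec (Store a b) (pc, R, M) = (Suc pc, R, M(R a := R b))"
| "exec (Jump j) (pc, R, M) = (j, R, M)"
| "exec (JumpZero a j) (pc, R, M) = (if R a = 0 then j else Suc pc, R, M)"

text \<open>The machine halts as soon as the program counter leaves the program.\<close>

definition halted :: "program \<Rightarrow> config \<Rightarrow> bool" where
  "halted P c \<longleftrightarrow> fst c \<ge> length P"

definition step :: "program \<Rightarrow> config \<Rightarrow> config" where
  "step P c = (if halted P c then c else exec (P ! fst c) c)"

definition initial :: "nat list \<Rightarrow> config" where
  "initial w = (0, \<lambda>_. 0, \<lambda>a. if a < length w then w ! a else 0)"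

text \<open>The answer is read off register 0: 1 means yes, 0 means no.\<close>

definition answers_within :: "program \<Rightarrow> nat list \<Rightarrow> bool \<Rightarrow> real \<Rightarrow> bool" where
  "answers_within P w b T \<longleftrightarrow>
     (\<exists>t::nat. \<exists>pc R M. real t \<le> T \<and> (step P ^^ t) (initial w) = (pc, R, M) \<and>
        halted P (pc, R, M) \<and> R 0 = of_bool b)"


section \<open>Input encoding\<close>

text \<open>
  Formulas are presented in the DIMACS format: the number \<open>n\<close> of variables, the number of
  clauses, and the clauses one after the other, each terminated by 0, where the variables are
  numbered from 1 to \<open>n\<close>. The numbering of the variables and the order in which clauses and
  literals are listed are arbitrary, so that one formula has many presentations.
\<close>

definition dimacs :: "nat \<Rightarrow> nat list list \<Rightarrow> nat list" where
  "dimacs n cs = n # length cs # concat (map (\<lambda>c. c @ [0]) cs)"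

definition presents :: "nat list \<Rightarrow> cnf \<Rightarrow> bool" where
  "presents w F \<longleftrightarrow>
     (\<exists>\<nu> cs. bij_betw \<nu> (vars F) {1..card (vars F)} \<and>
        (\<forall>c\<in>set cs. distinct c) \<and> distinct (map set cs) \<and>
        set ` set cs = (\<lambda>C. \<nu> ` C) ` F \<and>
        w = dimacs (card (vars F)) cs)"

lemma ex_presents:
  assumes "monotone_cnf F"
  shows "\<exists>w. presents w F"
proof -
  have fin: "finite F" "\<And>C. C \<in> F \<Longrightarrow> finite C"
    using assms by (auto simp: monotone_cnf_def)
  then have "finite (vars F)"
    by (auto simp: vars_def)
  then obtain \<nu> where \<nu>: "bij_betw \<nu> (vars F) {1..card (vars F)}"
    by (metis card_atLeastAtMost diff_Suc_1 finite_atLeastAtMost finite_same_card_bij)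
  define G where "G = (\<lambda>C. \<nu> ` C) ` F"
  have G: "finite G" "\<And>D. D \<in> G \<Longrightarrow> finite D"
    using fin by (auto simp: G_def)
  obtain Ds where Ds: "set Ds = G" "distinct Ds"
    using G(1) finite_distinct_list by blast
  define cs where "cs = map sorted_list_of_set Ds"
  have "map set cs = Ds"
    using G(2) Ds(1) by (auto simp: cs_def intro: map_idI)
  moreover from this have "set ` set cs = G"
    using Ds(1) by (metis list.set_map)
  moreover have "\<forall>c\<in>set cs. distinct c"
    by (auto simp: cs_def)
  ultimately have "presents (dimacs (card (vars F)) cs) F"
    unfolding presents_def using \<nu> Ds(2) G_def by metis
  then show ?thesis ..
qed

end

theory Submission imports Defs begin

text \<open>
  A clause \<open>C\<close> meets, by linearity, exactly \<open>k (l - 1)\<close> other clauses, so there are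
  \<open>m = 1 + k (l - 1) + l (l - 2)\<close> clauses, while \<open>n l = m k\<close>; hence \<open>m = O(sqrt n)\<close>. An exact
  cover consists of \<open>m / l\<close> variables, and exhaustive search over all sequences of at most \<open>m\<close>
  variables takes about \<open>(n + 1) ^ m = exp (O(ln n * sqrt n))\<close> rounds.

  To make the search easy for the machine, clause \<open>i\<close> gets the weight \<open>D + 2 ^ i\<close> with
  \<open>D = 8 * 2 ^ m\<close>, a variable the sum of the weights of its clauses, and the target is the sum of
  all weights. Since \<open>m\<close> powers of two below \<open>2 ^ m\<close> sum to \<open>-1\<close> modulo \<open>2 ^ m\<close> only if they
  are all distinct, a sequence of variables reaches the target iff it is an exact cover. The summand
  \<open>D\<close> bounds the length of the sequences; as \<open>D\<close> exceeds the input length, it also serves as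
  the address of the free memory. The search is depth-first on a stack of partial sums.
\<close>

section \<open>Bounded reachability\<close>

text \<open>An upper bound instead of an exact step count, since the lengths of the loops depend on
  the data; the bounds of consecutive segments simply add up.\<close>

definition leads :: "program \<Rightarrow> config \<Rightarrow> nat \<Rightarrow> (config \<Rightarrow> bool) \<Rightarrow> bool" where
  "leads P c T Q \<longleftrightarrow> (\<exists>t\<le>T. Q ((step P ^^ t) c))"

lemma leadsE:
  assumes "leads P c T Q"
  obtains t where "t \<le> T" "Q ((step P ^^ t) c)"
  using assms unfolding leads_def by blast

lemma leads_refl: "Q c \<Longrightarrow> leads P c T Q"
  unfolding leads_def by (metis funpow_0 le0)

lemma leads_trans:
  assumes "leads P c T Q" and "\<And>c'. Q c' \<Longrightarrow> leads P c' T' Q'"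
  shows "leads P c (T + T') Q'"
proof -
  obtain t where t: "t \<le> T" "Q ((step P ^^ t) c)"
    using assms(1) by (rule leadsE)
  then obtain t' where "t' \<le> T'" "Q' ((step P ^^ t') ((step P ^^ t) c))"
    using assms(2) unfolding leads_def by blast
  then have "t' + t \<le> T + T'" "Q' ((step P ^^ (t' + t)) c)"
    using t(1) by (auto simp: funpow_add)
  then show ?thesis
    unfolding leads_def by blast
qed

text \<open>For straight-line code: \<open>c'\<close> comes from symbolic execution, and
  \<open>T'\<close> may be any bound that leaves room for these \<open>s\<close> steps.\<close>

lemma leads_steps:
  assumes "(step P ^^ s) c = c'" and "leads P c' T Q" and "s + T \<le> T'"
  shows "leads P c T' Q"
proof -
  obtain t where t: "t \<le> T" "Q ((step P ^^ t) c')"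
    using assms(2) by (rule leadsE)
  then have "t + s \<le> T'" "Q ((step P ^^ (t + s)) c)"
    using assms(1,3) by (auto simp: funpow_add)
  then show ?thesis
    unfolding leads_def by blast
qed

lemma leads_mono: "leads P c T Q \<Longrightarrow> T \<le> T' \<Longrightarrow> (\<And>c'. Q c' \<Longrightarrow> Q' c') \<Longrightarrow> leads P c T' Q'"
  unfolding leads_def by (meson le_trans)

section \<open>The program\<close>

definition prog :: program where
  "prog = [
    \<comment> \<open>R2 := 8 * 2 ^ m\<close>
    Const 9 1, Load 11 9, Const 2 8,
    JumpZero 11 7, Add 2 2 2, Sub 11 11 9, Jump 3,
    \<comment> \<open>read the clauses; R3 = 2 ^ i and R4 = R2 + 2 ^ i while clause i is read\<close>
    Load 11 9, Const 3 1, Add 4 2 3, Const 5 2,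
    JumpZero 11 24, Load 6 5, Add 5 5 9, Add 7 2 6, Load 8 7, Add 8 8 4, Store 7 8,
    JumpZero 6 20, Jump 11,
    Add 4 4 3, Add 3 3 3, Sub 11 11 9, Jump 11,
    \<comment> \<open>R10 := n, R11 := target, R3 := bottom of the stack, R4 := top of the stack\<close>
    Load 10 0, Load 11 2, Add 3 2 10, Add 3 3 9, Add 4 3 9,
    \<comment> \<open>pop a partial sum into R5, compare it with the target, push its extensions\<close>
    Sub 6 4 3, JumpZero 6 48, Sub 4 4 9, Load 5 4, Sub 6 11 5, JumpZero 6 44, Move 6 10,
    JumpZero 6 29, Add 7 2 6, Load 8 7, Add 8 8 5, Store 4 8, Add 4 4 9, Sub 6 6 9, Jump 36,
    Sub 6 5 11, JumpZero 6 47, Jump 29,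
    Const 0 1]"

lemma length_prog: "length prog = 48"
  by (simp add: prog_def)

lemma step_prog: "pc < 48 \<Longrightarrow> step prog (pc, R, M) = exec (prog ! pc) (pc, R, M)"
  by (simp add: step_def halted_def length_prog)

text \<open>Carries out the innermost step first, so that the configuration stays explicit during
  symbolic execution.\<close>

lemma funpow_numeral: "(f ^^ numeral k) x = (f ^^ pred_numeral k) (f x)"
  by (simp add: numeral_eq_Suc funpow_swap1)

text \<open>Unfolds the program only below \<open>!\<close>, so that \<open>step prog\<close> stays
  folded.\<close>

lemma prog_nth: "P = prog \<Longrightarrow> prog ! i = P ! i"
  by simp

lemmas run = funpow_numeral step_prog prog_nth[OF prog_def[symmetric]]

section \<open>Computing the base weight and reading the clauses\<close>

text \<open>Register 11 counts down the rounds, each of four steps and one doubling; the extra step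
  is the exit jump.\<close>

lemma power_loop:
  "R 9 = 1 \<Longrightarrow>
   leads prog (3, R, M) (4 * R 11 + 1)
     (\<lambda>(pc, R', M'). pc = 7 \<and> R' 2 = R 2 * 2 ^ R 11 \<and> R' 9 = 1 \<and> R' 0 = R 0 \<and> M' = M)"
proof (induction "R 11" arbitrary: R)
  case 0
  have "(step prog ^^ 1) (3, R, M) = (7, R, M)"
    using 0 by (simp add: run)
  then show ?case
    by (rule leads_steps[where T = 0]) (use 0 in \<open>auto intro!: leads_refl\<close>)
next
  case (Suc j)
  have R11: "R 11 = Suc j"
    using Suc(2) by simp
  let ?R = "R(2 := R 2 + R 2, 11 := R 11 - 1)"
  have "(step prog ^^ 4) (3, R, M) = (3, ?R, M)"
    using Suc(2,3) by (simp add: run)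
  then show ?case
    by (rule leads_steps, intro leads_mono[OF Suc(1)[of ?R]])
      (use Suc(3) R11 in auto)
qed

text \<open>
  The terminator 0 is treated like a variable, so that the cell of variable 0 collects the sum
  of the weights of all clauses, which is the target.
\<close>

fun tot :: "nat list \<Rightarrow> nat \<Rightarrow> nat \<Rightarrow> nat \<Rightarrow> nat" where
  "tot [] W q x = 0"
| "tot (y # ys) W q x =
    (if y = x then W else 0) + (if y = 0 then tot ys (W + q) (q + q) x else tot ys W q x)"

text \<open>The memory after reading \<open>ys\<close>: the table of weights starts at address
  \<open>D\<close>, and the input below it is untouched.\<close>

definition add_tot :: "nat \<Rightarrow> nat list \<Rightarrow> nat \<Rightarrow> nat \<Rightarrow> (nat \<Rightarrow> nat) \<Rightarrow> nat \<Rightarrow> nat" where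
  "add_tot D ys W q M a = M a + (if a \<ge> D then tot ys W q (a - D) else 0)"

text \<open>Induction on the unread part \<open>ys\<close> of the input. It ends below
  \<open>R 2\<close>, so no write to the table destroys it, and as it ends with a terminator, the
  clause counter stays positive until all of it is read. A variable costs 9 steps, a terminator
  12.\<close>

lemma read_loop:
  "\<lbrakk>R 9 = 1; R 11 = count_list ys 0; ys \<noteq> [] \<Longrightarrow> last ys = 0; R 5 + length ys \<le> R 2;
    \<And>j. j < length ys \<Longrightarrow> M (R 5 + j) = ys ! j\<rbrakk> \<Longrightarrow>
   leads prog (11, R, M) (12 * length ys + 1)
     (\<lambda>(pc, R', M'). pc = 24 \<and> R' 2 = R 2 \<and> R' 9 = 1 \<and> R' 0 = R 0 \<and>
        M' = add_tot (R 2) ys (R 4) (R 3) M)"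
proof (induction ys arbitrary: R M)
  case Nil
  have "(step prog ^^ 1) (11, R, M) = (24, R, M)"
    using Nil by (simp add: run)
  then show ?case
    by (rule leads_steps[where T = 0])
      (use Nil in \<open>auto intro!: leads_refl simp: add_tot_def\<close>)
next
  case (Cons y ys)
  have y: "M (R 5) = y"
    using Cons.prems(5)[of 0] by simp
  have ys: "M (Suc (R 5 + j)) = ys ! j" if "j < length ys" for j
    using Cons.prems(5)[of "Suc j"] that by simp
  have "R 11 \<noteq> 0"
    using Cons.prems(2,3) by (metis count_list_0_iff last_in_set list.discI)
  let ?M = "M(R 2 + y := M (R 2 + y) + R 4)"
  let ?R = "R(6 := y, 5 := R 5 + 1, 7 := R 2 + y, 8 := M (R 2 + y) + R 4)"
  have last: "ys \<noteq> [] \<Longrightarrow> last ys = 0"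
    using Cons.prems(3) by simp
  show ?case
  proof (cases "y = 0")
    case True
    let ?R' = "?R(4 := R 4 + R 3, 3 := R 3 + R 3, 11 := R 11 - 1)"
    have "(step prog ^^ 12) (11, R, M) = (11, ?R', ?M)"
      using Cons.prems(1) \<open>R 11 \<noteq> 0\<close> y True by (simp add: run)
    then show ?thesis
      by (rule leads_steps, intro leads_mono[OF Cons.IH[of ?R' ?M]])
        (use Cons.prems last ys True in \<open>auto simp: add_tot_def fun_eq_iff\<close>)
  next
    case False
    have "(step prog ^^ 9) (11, R, M) = (11, ?R, ?M)"
      using Cons.prems(1) \<open>R 11 \<noteq> 0\<close> y False by (simp add: run)
    then show ?thesis
      by (rule leads_steps, intro leads_mono[OF Cons.IH[of ?R ?M]])
        (use Cons.prems last ys False in \<open>auto simp: add_tot_def fun_eq_iff\<close>)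
  qed
qed

section \<open>Depth-first search on the stack\<close>

text \<open>Variables are processed from \<open>R 6\<close> down to 1, hence the index
  \<open>R 6 - j\<close>. The stack top lies above the table, so the weights survive the
  pushes.\<close>

lemma push_loop:
  "\<lbrakk>R 9 = 1; R 2 + R 6 < R 4; \<And>x. x \<in> {1..R 6} \<Longrightarrow> M (R 2 + x) = a x\<rbrakk> \<Longrightarrow>
   leads prog (36, R, M) (8 * R 6 + 1)
     (\<lambda>(pc, R', M'). pc = 29 \<and> (\<forall>r\<in>{0, 2, 3, 9, 10, 11}. R' r = R r) \<and> R' 4 = R 4 + R 6 \<and>
        (\<forall>j<R 6. M' (R 4 + j) = R 5 + a (R 6 - j)) \<and> (\<forall>j<R 4. M' j = M j))"
proof (induction "R 6" arbitrary: R M)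
  case 0
  have "(step prog ^^ 1) (36, R, M) = (29, R, M)"
    using 0(1) by (simp add: run)
  then show ?case
    by (rule leads_steps[where T = 0]) (use 0(1) in \<open>auto intro!: leads_refl\<close>)
next
  case (Suc i)
  have R6: "R 6 = Suc i"
    using Suc(2) by simp
  have a: "M (R 2 + x) = a x" if "x \<in> {1..Suc i}" for x
    using Suc(5)[of x] that R6 by simp
  let ?M = "M(R 4 := a (Suc i) + R 5)"
  let ?R = "R(7 := R 2 + Suc i, 8 := a (Suc i) + R 5, 4 := R 4 + 1, 6 := i)"
  have "(step prog ^^ 8) (36, R, M) = (36, ?R, ?M)"
    using Suc(3) R6 a[of "Suc i"] by (simp add: run)
  then show ?case
  proof (rule leads_steps)
    show "leads prog (36, ?R, ?M) (8 * i + 1)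
     (\<lambda>(pc, R', M'). pc = 29 \<and> (\<forall>r\<in>{0, 2, 3, 9, 10, 11}. R' r = R r) \<and> R' 4 = R 4 + R 6 \<and>
        (\<forall>j<R 6. M' (R 4 + j) = R 5 + a (R 6 - j)) \<and> (\<forall>j<R 4. M' j = M j))"
    proof (rule leads_mono[OF Suc(1)[of ?R ?M]])
      fix c' :: config
      obtain pc R' M' where c': "c' = (pc, R', M')"
        by (cases c')
      assume "case c' of (pc, R', M') \<Rightarrow> pc = 29 \<and> (\<forall>r\<in>{0, 2, 3, 9, 10, 11}. R' r = ?R r) \<and>
        R' 4 = ?R 4 + ?R 6 \<and> (\<forall>j<?R 6. M' (?R 4 + j) = ?R 5 + a (?R 6 - j)) \<and>
        (\<forall>j<?R 4. M' j = ?M j)"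
      then have h: "pc = 29" "\<forall>r\<in>{0, 2, 3, 9, 10, 11}. R' r = R r" "R' 4 = R 4 + R 6"
        "\<And>j. j < i \<Longrightarrow> M' (Suc (R 4 + j)) = R 5 + a (i - j)"
        "\<And>j. j < Suc (R 4) \<Longrightarrow> M' j = ?M j"
        unfolding c' using R6 by auto
      \<comment> \<open>Cell \<open>j = 0\<close> was written in this round and is preserved later;
        the others come from the induction hypothesis, shifted by one.\<close>
      have "M' (R 4 + j) = R 5 + a (R 6 - j)" if "j < R 6" for j
        using h(4)[of "j - 1"] h(5)[of "R 4"] that R6 by (cases j) auto
      then show "case c' of (pc, R', M') \<Rightarrow> pc = 29 \<and> (\<forall>r\<in>{0, 2, 3, 9, 10, 11}. R' r = R r) \<and>
        R' 4 = R 4 + R 6 \<and> (\<forall>j<R 6. M' (R 4 + j) = R 5 + a (R 6 - j)) \<and> (\<forall>j<R 4. M' j = M j)"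
        using h by (auto simp: c')
    qed (use Suc(3,4) R6 a in auto)
  qed (simp add: R6)
qed

text \<open>Lists rather than sets, since the search may choose a variable repeatedly; what reaching
  the target means for covers is left to the weights.\<close>

definition reach :: "(nat \<Rightarrow> nat) \<Rightarrow> nat \<Rightarrow> nat \<Rightarrow> nat \<Rightarrow> bool" where
  "reach a n t v \<longleftrightarrow> (\<exists>xs. set xs \<subseteq> {1..n} \<and> v + sum_list (map a xs) = t)"

lemma reach_self: "reach a n t t"
  unfolding reach_def by (rule exI[of _ "[]"]) simp

lemma reach_gt: "t < v \<Longrightarrow> \<not> reach a n t v"
  unfolding reach_def by auto

text \<open>Below the target at least one more variable is needed, and the first one can be split
  off. This is the recursion performed by the search.\<close>

lemma reach_lt:
  assumes "v < t"
  shows "reach a n t v \<longleftrightarrow> (\<exists>x\<in>{1..n}. reach a n t (v + a x))"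
proof
  assume "reach a n t v"
  then obtain xs where xs: "set xs \<subseteq> {1..n}" "v + sum_list (map a xs) = t"
    unfolding reach_def by blast
  then obtain x ys where "xs = x # ys"
    using assms by (cases xs) auto
  then show "\<exists>x\<in>{1..n}. reach a n t (v + a x)"
    unfolding reach_def using xs by (intro bexI[of _ x] exI[of _ ys]) auto
next
  assume "\<exists>x\<in>{1..n}. reach a n t (v + a x)"
  then obtain x xs where "x \<in> {1..n}" "set xs \<subseteq> {1..n}" "v + a x + sum_list (map a xs) = t"
    unfolding reach_def by blast
  then show "reach a n t v"
    unfolding reach_def by (intro exI[of _ "x # xs"]) auto
qed

text \<open>
  Bounds how often the stack is popped on behalf of the entry \<open>v\<close> if every variable weighs at
  least \<open>c\<close>: the exponent is 0 for \<open>v > t\<close> and drops with each added variable.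
\<close>

definition pops :: "nat \<Rightarrow> nat \<Rightarrow> nat \<Rightarrow> nat \<Rightarrow> nat" where
  "pops c n t v = (n + 1) ^ ((t + c - v) div c)"

text \<open>Each of the \<open>n\<close> extensions has an exponent smaller by at least one, and
  \<open>n * (n + 1) ^ e < (n + 1) ^ (e + 1)\<close>. Strictness pays for popping \<open>v\<close>
  itself.\<close>

lemma pops_step:
  assumes "v < t" and "0 < c" and "\<And>x. x \<in> {1..n} \<Longrightarrow> c \<le> a x"
  shows "(\<Sum>j<n. pops c n t (v + a (n - j))) < pops c n t v"
proof -
  have eq: "(t + c - v) div c = Suc ((t - v) div c)"
    using assms(1,2) div_add_self2[of c "t - v"] by simp
  have "pops c n t (v + a (n - j)) \<le> (n + 1) ^ ((t - v) div c)" if "j < n" for j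
  proof -
    have "c \<le> a (n - j)"
      using assms(3)[of "n - j"] that by auto
    then show ?thesis
      unfolding pops_def by (intro power_increasing div_le_mono) auto
  qed
  then have "(\<Sum>j<n. pops c n t (v + a (n - j))) \<le> (\<Sum>j<n. (n + 1) ^ ((t - v) div c))"
    by (intro sum_mono) auto
  also have "\<dots> < pops c n t v"
    by (simp add: pops_def eq)
  finally show ?thesis .
qed

text \<open>Induction on the potential, the sum of \<open>pops\<close> over the stack, which drops
  with every pop. A pop costs 9 steps if no extension is pushed and \<open>7 + (8 * n + 1)\<close>
  otherwise, so \<open>8 * n + 9\<close> covers both; the final \<open>+ 1\<close> pays for
  detecting the empty stack.\<close>

lemma search_loop:
  assumes "0 < c" and "\<And>x. x \<in> {1..n} \<Longrightarrow> c \<le> a x"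
  shows "\<lbrakk>R 0 = 0; R 9 = 1; R 10 = n; R 11 = t; R 3 = R 2 + n + 1; R 4 = R 3 + length \<sigma>;
    \<And>j. j < length \<sigma> \<Longrightarrow> M (R 3 + j) = \<sigma> ! j; \<And>x. x \<in> {1..n} \<Longrightarrow> M (R 2 + x) = a x\<rbrakk> \<Longrightarrow>
    leads prog (29, R, M) ((8 * n + 9) * (sum_list (map (pops c n t) \<sigma>) + 1))
      (\<lambda>(pc, R', M'). pc = 48 \<and> R' 0 = of_bool (\<exists>v\<in>set \<sigma>. reach a n t v))"
proof (induction "sum_list (map (pops c n t) \<sigma>)" arbitrary: \<sigma> R M rule: less_induct)
  case less
  note R = less.prems(1-6) and stack = less.prems(7) and arr = less.prems(8)
  let ?Q = "\<lambda>(pc, R', M'). pc = 48 \<and> R' 0 = of_bool (\<exists>v\<in>set \<sigma>. reach a n t v)"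
  let ?\<Phi> = "\<lambda>\<sigma>. sum_list (map (pops c n t) \<sigma>)"
  have pos: "0 < pops c n t v" for v
    by (simp add: pops_def)
  show ?case
  \<comment> \<open>The top of the stack is the end of the list.\<close>
  proof (cases \<sigma> rule: rev_cases)
    case Nil
    have "(step prog ^^ 2) (29, R, M) = (48, R(6 := 0), M)"
      using R Nil by (simp add: run)
    then show ?thesis
      by (rule leads_steps[where T = 0]) (use R Nil in \<open>auto intro!: leads_refl\<close>)
  next
    case (snoc \<rho> v)
    have v: "M (R 3 + length \<rho>) = v"
      using stack[of "length \<rho>"] snoc by simp
    have \<rho>: "M (R 3 + j) = \<rho> ! j" if "j < length \<rho>" for j
      using stack[of j] snoc that by (simp add: nth_append)
    have \<Phi>: "?\<Phi> \<sigma> = ?\<Phi> \<rho> + pops c n t v"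
      by (simp add: snoc)
    consider "v < t" | "v = t" | "t < v"
      by linarith
    then show ?thesis
    proof cases
      case 1
      let ?R = "R(4 := R 3 + length \<rho>, 5 := v, 6 := n)"
      let ?\<tau> = "\<rho> @ map (\<lambda>j. v + a (n - j)) [0..<n]"
      have "?\<Phi> ?\<tau> = ?\<Phi> \<rho> + (\<Sum>j<n. pops c n t (v + a (n - j)))"
        by (simp add: comp_def interv_sum_list_conv_sum_set_nat atLeast0LessThan)
      also have "\<dots> < ?\<Phi> \<sigma>"
        using pops_step[of v t c n a] 1 assms \<Phi> by simp
      finally have lt: "?\<Phi> ?\<tau> < ?\<Phi> \<sigma>" .
      \<comment> \<open>Replacing \<open>v\<close> by its extensions does not change the answer;
        \<open>x = n - j\<close> translates between stack positions and variables.\<close>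
      have set: "(\<exists>u\<in>set ?\<tau>. reach a n t u) \<longleftrightarrow> (\<exists>u\<in>set \<sigma>. reach a n t u)"
      proof -
        have "(\<exists>j<n. reach a n t (v + a (n - j))) \<longleftrightarrow> (\<exists>x\<in>{1..n}. reach a n t (v + a x))"
        proof
          assume "\<exists>x\<in>{1..n}. reach a n t (v + a x)"
          then obtain x where "x \<in> {1..n}" "reach a n t (v + a x)"
            by blast
          then show "\<exists>j<n. reach a n t (v + a (n - j))"
            by (intro exI[of _ "n - x"]) auto
        next
          assume "\<exists>j<n. reach a n t (v + a (n - j))"
          then obtain j where "j < n" "reach a n t (v + a (n - j))"
            by blast
          then show "\<exists>x\<in>{1..n}. reach a n t (v + a x)"
            by (intro bexI[of _ "n - j"]) auto
        qed
        then show ?thesis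
          using reach_lt[OF 1, of a n] by (auto simp: snoc)
      qed
      have "(step prog ^^ 7) (29, R, M) = (36, ?R, M)"
        using R snoc v 1 by (simp add: run)
      then show ?thesis
      proof (rule leads_steps)
        show "leads prog (36, ?R, M) ((8 * n + 1) + (8 * n + 9) * (?\<Phi> ?\<tau> + 1)) ?Q"
        proof (rule leads_trans)
          show "leads prog (36, ?R, M) (8 * n + 1)
            (\<lambda>(pc, R', M'). pc = 29 \<and> (\<forall>r\<in>{0, 2, 3, 9, 10, 11}. R' r = ?R r) \<and>
              R' 4 = ?R 4 + n \<and> (\<forall>j<n. M' (?R 4 + j) = ?R 5 + a (n - j)) \<and>
              (\<forall>j<?R 4. M' j = M j))"
            using push_loop[of ?R M a] R arr by simp
        next
          fix c' :: config
          obtain pc R' M' where c': "c' = (pc, R', M')"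
            by (cases c')
          assume "case c' of (pc, R', M') \<Rightarrow> pc = 29 \<and> (\<forall>r\<in>{0, 2, 3, 9, 10, 11}. R' r = ?R r) \<and>
              R' 4 = ?R 4 + n \<and> (\<forall>j<n. M' (?R 4 + j) = ?R 5 + a (n - j)) \<and>
              (\<forall>j<?R 4. M' j = M j)"
          then have h: "pc = 29" "R' 0 = R 0" "R' 2 = R 2" "R' 3 = R 3" "R' 9 = R 9"
            "R' 10 = R 10" "R' 11 = R 11" "R' 4 = R 3 + length \<rho> + n"
            "\<And>j. j < n \<Longrightarrow> M' (R 3 + length \<rho> + j) = v + a (n - j)"
            "\<And>j. j < R 3 + length \<rho> \<Longrightarrow> M' j = M j"
            unfolding c' by auto
          have "leads prog (29, R', M') ((8 * n + 9) * (?\<Phi> ?\<tau> + 1))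
            (\<lambda>(pc, R', M'). pc = 48 \<and> R' 0 = of_bool (\<exists>u\<in>set ?\<tau>. reach a n t u))"
          proof (rule less.hyps[OF lt])
            fix j
            assume "j < length ?\<tau>"
            then show "M' (R' 3 + j) = ?\<tau> ! j"
              using h(4) h(9)[of "j - length \<rho>"] h(10)[of "R 3 + j"] \<rho>[of j]
              by (auto simp: nth_append)
          next
            fix x
            assume "x \<in> {1..n}"
            then show "M' (R' 2 + x) = a x"
              using h(3) h(10)[of "R 2 + x"] arr[of x] R(5) by auto
          qed (use h R in auto)
          then show "leads prog c' ((8 * n + 9) * (?\<Phi> ?\<tau> + 1)) ?Q"
            unfolding c' h(1) set .
        qed
      next
        have "7 + (8 * n + 1 + (8 * n + 9) * (?\<Phi> ?\<tau> + 1)) \<le> (8 * n + 9) * (?\<Phi> ?\<tau> + 1 + 1)"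
          by simp
        also have "\<dots> \<le> (8 * n + 9) * (?\<Phi> \<sigma> + 1)"
          using lt by (intro mult_left_mono) auto
        finally show "7 + (8 * n + 1 + (8 * n + 9) * (?\<Phi> ?\<tau> + 1)) \<le> (8 * n + 9) * (?\<Phi> \<sigma> + 1)" .
      qed
    next
      case 2
      have "(step prog ^^ 9) (29, R, M)
        = (48, R(4 := R 3 + length \<rho>, 5 := v, 6 := 0, 0 := 1), M)"
        using R snoc v 2 by (simp add: run)
      then show ?thesis
        by (rule leads_steps[where T = 0])
          (use 2 reach_self[of a n t] in \<open>auto intro!: leads_refl simp: snoc\<close>)
    next
      case 3
      let ?R = "R(4 := R 3 + length \<rho>, 5 := v, 6 := v - t)"
      have lt: "?\<Phi> \<rho> < ?\<Phi> \<sigma>"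
        using \<Phi> pos[of v] by simp
      have "(step prog ^^ 9) (29, R, M) = (29, ?R, M)"
        using R snoc v 3 by (simp add: run)
      then show ?thesis
      proof (rule leads_steps)
        have "leads prog (29, ?R, M) ((8 * n + 9) * (?\<Phi> \<rho> + 1))
          (\<lambda>(pc, R', M'). pc = 48 \<and> R' 0 = of_bool (\<exists>u\<in>set \<rho>. reach a n t u))"
          by (rule less.hyps[OF lt]) (use R \<rho> arr in auto)
        then show "leads prog (29, ?R, M) ((8 * n + 9) * (?\<Phi> \<rho> + 1)) ?Q"
          using reach_gt[OF 3, of a n] by (simp add: snoc)
      next
        have "9 + (8 * n + 9) * (?\<Phi> \<rho> + 1) \<le> (8 * n + 9) * (?\<Phi> \<rho> + 1 + 1)"
          by simp
        also have "\<dots> \<le> (8 * n + 9) * (?\<Phi> \<sigma> + 1)"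
          using lt by (intro mult_left_mono) auto
        finally show "9 + (8 * n + 9) * (?\<Phi> \<rho> + 1) \<le> (8 * n + 9) * (?\<Phi> \<sigma> + 1)" .
      qed
    qed
  qed
qed

section \<open>Weights of clauses\<close>

text \<open>The term \<open>e\<close> is the carry into the lowest digit.\<close>

lemma binary_sum_ge:
  fixes c :: "nat \<Rightarrow> nat"
  assumes "2 ^ m dvd Suc (e + (\<Sum>i<m. c i * 2 ^ i))"
  shows "m \<le> e + (\<Sum>i<m. c i)"
  using assms
proof (induction m arbitrary: e c)
  case (Suc m)
  have split: "(\<Sum>i<Suc m. c i * 2 ^ i) = c 0 + 2 * (\<Sum>i<m. c (Suc i) * 2 ^ i)"
    by (simp add: sum.lessThan_Suc_shift sum_distrib_left mult_ac del: sum.lessThan_Suc)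
  have "2 dvd Suc (e + (\<Sum>i<Suc m. c i * 2 ^ i))"
    using Suc.prems by (metis dvd_mult_left power_Suc)
  then have "odd (e + c 0)"
    unfolding split by simp
  then obtain e' where e': "e + c 0 = 2 * e' + 1"
    by (elim oddE)
  have "Suc (e + (\<Sum>i<Suc m. c i * 2 ^ i)) = 2 * Suc (e' + (\<Sum>i<m. c (Suc i) * 2 ^ i))"
    unfolding split using e' by simp
  then have "2 * 2 ^ m dvd 2 * Suc (e' + (\<Sum>i<m. c (Suc i) * 2 ^ i))"
    using Suc.prems by (simp only: power_Suc)
  then have "2 ^ m dvd Suc (e' + (\<Sum>i<m. c (Suc i) * 2 ^ i))"
    by (simp only: nat_mult_dvd_cancel_disj) simp
  then have "m \<le> e' + (\<Sum>i<m. c (Suc i))"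
    using Suc.IH[of e' "\<lambda>i. c (Suc i)"] by simp
  \<comment> \<open>The lowest digit uses \<open>e + c 0 = 2 * e' + 1\<close>, which is at least
    \<open>e' + 1\<close>: passing on a carry never saves summands.\<close>
  then show ?case
    using e' by (simp add: sum.lessThan_Suc_shift del: sum.lessThan_Suc)
qed simp

text \<open>The lowest multiplicity is odd, say \<open>2 * e + 1\<close>. Its carry \<open>e\<close>
  can spare at most \<open>e\<close> of the \<open>m\<close> later summands, while it costs
  \<open>2 * e\<close> extra ones, so the bound on the total forces \<open>e = 0\<close>; then
  induct on the remaining digits.\<close>

lemma binary_sum_unique:
  fixes c :: "nat \<Rightarrow> nat"
  assumes "2 ^ m dvd Suc (\<Sum>i<m. c i * 2 ^ i)" and "(\<Sum>i<m. c i) \<le> m" and "i < m"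
  shows "c i = 1"
  using assms
proof (induction m arbitrary: c i)
  case (Suc m)
  have split: "(\<Sum>i<Suc m. c i * 2 ^ i) = c 0 + 2 * (\<Sum>i<m. c (Suc i) * 2 ^ i)"
    by (simp add: sum.lessThan_Suc_shift sum_distrib_left mult_ac del: sum.lessThan_Suc)
  have "2 dvd Suc (\<Sum>i<Suc m. c i * 2 ^ i)"
    using Suc.prems(1) by (metis dvd_mult_left power_Suc)
  then have "odd (c 0)"
    unfolding split by simp
  then obtain e where e: "c 0 = 2 * e + 1"
    by (elim oddE)
  have "Suc (\<Sum>i<Suc m. c i * 2 ^ i) = 2 * Suc (e + (\<Sum>i<m. c (Suc i) * 2 ^ i))"
    unfolding split using e by simp
  then have "2 * 2 ^ m dvd 2 * Suc (e + (\<Sum>i<m. c (Suc i) * 2 ^ i))"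
    using Suc.prems(1) by (simp only: power_Suc)
  then have dvd: "2 ^ m dvd Suc (e + (\<Sum>i<m. c (Suc i) * 2 ^ i))"
    by (simp only: nat_mult_dvd_cancel_disj) simp
  have "c 0 + (\<Sum>i<m. c (Suc i)) \<le> Suc m"
    using Suc.prems(2) by (simp add: sum.lessThan_Suc_shift del: sum.lessThan_Suc)
  then have "e = 0" "(\<Sum>i<m. c (Suc i)) \<le> m"
    using binary_sum_ge[OF dvd] e by linarith+
  then show ?case
    using Suc.IH[of "\<lambda>i. c (Suc i)" "i - 1"] dvd e Suc.prems(3) by (cases i) auto
qed simp

text \<open>The target is \<open>m * D + 2 ^ m - 1\<close>. Modulo \<open>2 ^ m\<close> the
  multiples of \<open>D\<close> vanish, which leaves the divisibility for the powers of two;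
  comparing sizes, with \<open>2 ^ m \<le> D\<close>, shows that at most \<open>m\<close> summands
  occur.\<close>

lemma weight_sum_unique:
  fixes c :: "nat \<Rightarrow> nat"
  assumes "2 ^ m dvd D" and "0 < D"
    and "(\<Sum>i<m. c i * (D + 2 ^ i)) = (\<Sum>i<m. D + 2 ^ i)" and "i < m"
  shows "c i = 1"
proof -
  have "Suc (\<Sum>i<m. (2::nat) ^ i) = 2 ^ m"
    by (induction m) auto
  then have eq: "(\<Sum>i<m. c i) * D + Suc (\<Sum>i<m. c i * 2 ^ i) = m * D + 2 ^ m"
    using assms(3) by (simp add: sum.distrib sum_distrib_right distrib_left)
  have "2 ^ m dvd m * D + 2 ^ m"
    using assms(1) by simp
  then have dvd: "2 ^ m dvd Suc (\<Sum>i<m. c i * 2 ^ i)"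
    unfolding eq[symmetric] using assms(1) by (metis dvd_add_right_iff dvd_mult)
  have "2 ^ m \<le> D"
    using assms(1,2) dvd_imp_le by blast
  then have "(\<Sum>i<m. c i) * D < Suc m * D"
    using eq by simp
  then have "(\<Sum>i<m. c i) < Suc m"
    by (metis mult_less_cancel2)
  then have "(\<Sum>i<m. c i) \<le> m"
    by simp
  then show ?thesis
    using binary_sum_unique[OF dvd _ assms(4)] by blast
qed

section \<open>Variable weights and exact covers\<close>

lemma tot_clause:
  "0 \<notin> set c \<Longrightarrow> tot (c @ 0 # ys) W q x = count_list (c @ [0]) x * W + tot ys (W + q) (q + q) x"
  by (induction c) auto

text \<open>Stated for every starting power \<open>q\<close>, because each terminator doubles it;
  the actual run starts with \<open>q = 1\<close>.\<close>

lemma tot_clauses: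
  "(\<And>c. c \<in> set cs \<Longrightarrow> 0 \<notin> set c) \<Longrightarrow>
   tot (concat (map (\<lambda>c. c @ [0]) cs)) (D + q) q x
     = (\<Sum>j<length cs. count_list (cs ! j @ [0]) x * (D + 2 ^ j * q))"
proof (induction cs arbitrary: q)
  case (Cons c cs)
  have double: "2 ^ j * (q + q) = 2 ^ Suc j * q" for j
    by simp
  have "tot (concat (map (\<lambda>c. c @ [0]) (c # cs))) (D + q) q x
    = count_list (c @ [0]) x * (D + q) + tot (concat (map (\<lambda>c. c @ [0]) cs)) (D + (q + q)) (q + q) x"
    using Cons.prems by (simp add: tot_clause add.assoc)
  also have "\<dots> = count_list (c @ [0]) x * (D + q)
      + (\<Sum>j<length cs. count_list (cs ! j @ [0]) x * (D + 2 ^ j * (q + q)))"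
    using Cons by simp
  also have "\<dots> = (\<Sum>j<length (c # cs). count_list ((c # cs) ! j @ [0]) x * (D + 2 ^ j * q))"
    by (simp add: sum.lessThan_Suc_shift double del: sum.lessThan_Suc power_Suc)
  finally show ?case .
qed simp

lemma tot_notin: "x \<notin> set ys \<Longrightarrow> tot ys W q x = 0"
  by (induction ys W q x rule: tot.induct) auto

lemma count_list_distinct: "distinct xs \<Longrightarrow> count_list xs x = of_bool (x \<in> set xs)"
  by (induction xs) auto

lemma tot_var:
  assumes "\<And>c. c \<in> set cs \<Longrightarrow> distinct c \<and> 0 \<notin> set c" and "x \<noteq> 0"
  shows "tot (concat (map (\<lambda>c. c @ [0]) cs)) (D + 1) 1 x
    = (\<Sum>j<length cs. of_bool (x \<in> set (cs ! j)) * (D + 2 ^ j))"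
  using assms by (subst tot_clauses) (auto intro!: sum.cong simp: count_list_distinct)

lemma tot_zero:
  assumes "\<And>c. c \<in> set cs \<Longrightarrow> 0 \<notin> set c"
  shows "tot (concat (map (\<lambda>c. c @ [0]) cs)) (D + 1) 1 0 = (\<Sum>j<length cs. D + 2 ^ j)"
  using assms by (subst tot_clauses) (auto intro!: sum.cong simp: count_list_0_iff)

text \<open>Let \<open>?n xs j\<close> count the entries of \<open>xs\<close> in clause
  \<open>j\<close>, with repetition. The weight of \<open>xs\<close> is then a combination of the
  clause weights with these multiplicities, so it meets the target iff all of them are 1.\<close>

lemma reach_iff_exact_cover:
  assumes cs: "\<And>c. c \<in> set cs \<Longrightarrow> distinct c \<and> set c \<subseteq> {1..n}"
    and D: "2 ^ length cs dvd D" "0 < D"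
    and a: "a = tot (concat (map (\<lambda>c. c @ [0]) cs)) (D + 1) 1"
  shows "reach a n (a 0) 0 \<longleftrightarrow> (\<exists>X\<subseteq>{1..n}. \<forall>c\<in>set cs. card (X \<inter> set c) = 1)"
proof -
  let ?m = "length cs" and ?n = "\<lambda>xs j. length (filter (\<lambda>x. x \<in> set (cs ! j)) xs)"
  have cs0: "distinct c \<and> 0 \<notin> set c" if "c \<in> set cs" for c
    using cs[OF that] by auto
  have a0: "a 0 = (\<Sum>j<?m. D + 2 ^ j)"
    unfolding a by (intro tot_zero) (use cs0 in auto)
  have sum: "sum_list (map a xs) = (\<Sum>j<?m. ?n xs j * (D + 2 ^ j))" if "set xs \<subseteq> {1..n}" for xs
    using that
  proof (induction xs)
    case (Cons x xs)
    have "a x = (\<Sum>j<?m. of_bool (x \<in> set (cs ! j)) * (D + 2 ^ j))"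
      unfolding a by (intro tot_var) (use cs0 Cons.prems in auto)
    then have "sum_list (map a (x # xs))
      = (\<Sum>j<?m. (of_bool (x \<in> set (cs ! j)) + ?n xs j) * (D + 2 ^ j))"
      using Cons by (simp only: list.map sum_list.Cons sum.distrib distrib_right) simp
    also have "\<dots> = (\<Sum>j<?m. ?n (x # xs) j * (D + 2 ^ j))"
      by (intro sum.cong) auto
    finally show ?case .
  qed simp
  have "\<exists>X\<subseteq>{1..n}. \<forall>c\<in>set cs. card (X \<inter> set c) = 1"
    if xs: "set xs \<subseteq> {1..n}" "sum_list (map a xs) = a 0" for xs
  proof (intro exI[of _ "set xs"] conjI ballI)
    fix c
    assume "c \<in> set cs"
    then obtain j where j: "j < ?m" "c = cs ! j"
      by (metis in_set_conv_nth)
    then have "?n xs j = 1"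
      using weight_sum_unique[OF D, of "?n xs"] sum[OF xs(1)] xs(2) a0 by simp
    then obtain y where "filter (\<lambda>x. x \<in> set (cs ! j)) xs = [y]"
      by (metis One_nat_def length_0_conv length_Suc_conv)
    then have "set (filter (\<lambda>x. x \<in> set c) xs) = {y}"
      unfolding j(2) by simp
    moreover have "set xs \<inter> set c = set (filter (\<lambda>x. x \<in> set c) xs)"
      by auto
    ultimately have "set xs \<inter> set c = {y}"
      by (rule trans[rotated])
    then show "card (set xs \<inter> set c) = 1"
      by simp
  qed (rule xs(1))
  moreover have "\<exists>xs. set xs \<subseteq> {1..n} \<and> sum_list (map a xs) = a 0"
    if X: "X \<subseteq> {1..n}" "\<forall>c\<in>set cs. card (X \<inter> set c) = 1" for X
  proof -
    obtain xs where xs: "set xs = X" "distinct xs"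
      using X(1) by (meson finite_atLeastAtMost finite_distinct_list finite_subset)
    have "?n xs j = 1" if "j < ?m" for j
    proof -
      have "?n xs j = card (set (filter (\<lambda>x. x \<in> set (cs ! j)) xs))"
        by (rule distinct_card[OF distinct_filter[OF xs(2)], symmetric])
      also have "set (filter (\<lambda>x. x \<in> set (cs ! j)) xs) = X \<inter> set (cs ! j)"
        using xs(1) by auto
      finally show ?thesis
        using X(2) that by simp
    qed
    then have "sum_list (map a xs) = a 0"
      using sum[of xs] xs(1) X(1) a0 by simp
    then show ?thesis
      using xs(1) X(1) by blast
  qed
  ultimately show ?thesis
    unfolding reach_def add_0 by blast
qed

section \<open>Correctness and running time of the program\<close>

text \<open>The bound on \<open>L\<close> keeps the input below the table. In the step count, 14
  collects the straight-line parts and the exits of the first two loops. Every variable lies in a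
  clause and so weighs at least \<open>8 * 2 ^ length cs\<close>, as the search bound
  requires.\<close>

lemma prog_correct:
  assumes cs: "\<And>c. c \<in> set cs \<Longrightarrow> distinct c" and vars: "\<Union> (set ` set cs) = {1..n}"
    and len: "L = length (concat (map (\<lambda>c. c @ [0]) cs))" "2 + L \<le> 8 * 2 ^ length cs"
  shows "leads prog (initial (dimacs n cs))
    (14 + 4 * length cs + 12 * L + (8 * n + 9) * ((n + 1) ^ (length cs + 1) + 1))
    (\<lambda>(pc, R, M). pc = 48 \<and> R 0 = of_bool (\<exists>X\<subseteq>{1..n}. \<forall>c\<in>set cs. card (X \<inter> set c) = 1))"
proof -
  let ?m = "length cs" and ?D = "8 * 2 ^ length cs :: nat"
  let ?ys = "concat (map (\<lambda>c. c @ [0]) cs)"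
  let ?Q = "\<lambda>(pc, R, M::nat \<Rightarrow> nat).
    pc = (48::nat) \<and> R (0::nat) = (of_bool (\<exists>X\<subseteq>{1..n}. \<forall>c\<in>set cs. card (X \<inter> set c) = 1) :: nat)"
  define M where "M = (\<lambda>a. if a < length (dimacs n cs) then dimacs n cs ! a else 0)"
  have M01: "M 0 = n" "M (Suc 0) = ?m"
    by (auto simp: M_def dimacs_def)
  have Mys: "M (2 + j) = ?ys ! j" if "j < L" for j
    using that by (simp add: M_def dimacs_def len(1))
  have Mhigh: "M j = 0" if "?D \<le> j" for j
    using that len by (simp add: M_def dimacs_def)
  have cs0: "distinct c \<and> 0 \<notin> set c" "set c \<subseteq> {1..n}" if "c \<in> set cs" for c
  proof -
    show sub: "set c \<subseteq> {1..n}"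
      using vars that by blast
    show "distinct c \<and> 0 \<notin> set c"
      using cs[OF that] sub by auto
  qed
  have count: "count_list ?ys 0 = ?m"
  proof -
    have "\<forall>c\<in>set cs. 0 \<notin> set c"
      using cs0(1) by blast
    then show ?thesis
      by (induction cs) (auto simp: count_list_0_iff)
  qed
  have last: "?ys \<noteq> [] \<Longrightarrow> last ?ys = 0"
    by (induction cs rule: rev_induct) auto
  define a where "a = tot ?ys (?D + 1) 1"
  define c :: nat where "c = ?D"
  have c: "0 < c" "2 ^ ?m dvd c"
    by (auto simp: c_def)
  have a_ge: "c \<le> a x" if "x \<in> {1..n}" for x
  proof -
    obtain d where "d \<in> set cs" "x \<in> set d"
      using vars \<open>x \<in> {1..n}\<close> by blast
    then obtain j where j: "j < ?m" "x \<in> set (cs ! j)"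
      by (metis in_set_conv_nth)
    have "a x = (\<Sum>j<?m. of_bool (x \<in> set (cs ! j)) * (?D + 2 ^ j))"
      unfolding a_def by (intro tot_var) (use cs0 that in auto)
    also have "\<dots> \<ge> of_bool (x \<in> set (cs ! j)) * (?D + 2 ^ j)"
      using j(1) by (intro member_le_sum) auto
    finally show ?thesis
      using j(2) by (simp add: c_def)
  qed
  \<comment> \<open>The target is \<open>?m * c + 2 ^ ?m - 1\<close>, which is less than
    \<open>(?m + 1) * c\<close>, so the exponent at the root is at most
    \<open>?m + 1\<close>.\<close>
  have "pops c n (a 0) 0 \<le> (n + 1) ^ (?m + 1)"
  proof -
    have "a 0 = (\<Sum>j<?m. ?D + 2 ^ j)"
      unfolding a_def by (intro tot_zero) (use cs0 in auto)
    also have "Suc \<dots> = ?m * ?D + 2 ^ ?m"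
    proof -
      have "Suc (\<Sum>j<k. (2::nat) ^ j) = 2 ^ k" for k
        by (induction k) auto
      then show ?thesis
        by (simp add: sum.distrib)
    qed
    finally have "Suc (a 0) = ?m * ?D + 2 ^ ?m" .
    moreover have "(2::nat) ^ ?m \<le> c"
      by (simp add: c_def)
    ultimately have "a 0 + c < (?m + 2) * c"
      by (simp add: c_def)
    then have "(a 0 + c) div c < ?m + 2"
      using c(1) by (simp add: less_mult_imp_div_less)
    then show ?thesis
      unfolding pops_def by (intro power_increasing) auto
  qed
  then have bound: "(8 * n + 9) * (sum_list (map (pops c n (a 0)) [0]) + 1)
    \<le> (8 * n + 9) * ((n + 1) ^ (?m + 1) + 1)"
    by (intro mult_left_mono) auto
  have start: "(step prog ^^ 3) (initial (dimacs n cs))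
    = (3, (\<lambda>_. 0)(9 := 1, 11 := ?m, 2 := 8), M)"
    using M01 by (simp add: initial_def run flip: M_def)
  have finish: "leads prog (24, R, add_tot ?D ?ys (?D + 1) 1 M)
      (5 + (8 * n + 9) * (sum_list (map (pops c n (a 0)) [0]) + 1)) ?Q"
    if "R 2 = ?D" "R 9 = 1" "R 0 = 0" for R
  proof -
    let ?M = "add_tot ?D ?ys (?D + 1) 1 M"
    let ?R = "R(10 := n, 11 := a 0, 3 := ?D + n + 1, 4 := ?D + n + 2)"
    have arr: "?M (?D + x) = a x" for x
      by (simp add: add_tot_def a_def Mhigh)
    \<comment> \<open>Register 0 is still 0, so \<open>Load 10 0\<close> reads address 0, where
      \<open>n\<close> is stored.\<close>
    have "?M 0 = n"
      by (simp add: add_tot_def M01)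
    then have "(step prog ^^ 5) (24, R, ?M) = (29, ?R, ?M)"
      using that arr[of 0] by (simp add: run)
    then show ?thesis
    proof (rule leads_steps)
      \<comment> \<open>The cell just above the table was never written. Its value 0 serves as the
        initial partial sum, so the stack \<open>[0]\<close> needs no store instruction.\<close>
      have "tot ?ys W q x = 0" if "n < x" for W q x
      proof -
        have "x \<notin> set ?ys"
        proof
          assume "x \<in> set ?ys"
          then obtain c where "c \<in> set cs" "x \<in> set (c @ [0])"
            unfolding set_concat set_map by blast
          then show False
            using cs0(2)[of c] that by auto
        qed
        then show ?thesis
          by (rule tot_notin)
      qed
      then have bottom: "?M (?D + n + 1) = 0"
        using arr[of "n + 1"] by (simp add: a_def add.assoc)
      have "leads prog (29, ?R, ?M) ((8 * n + 9) * (sum_list (map (pops c n (a 0)) [0]) + 1))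
        (\<lambda>(pc, R', M'). pc = 48 \<and> R' 0 = of_bool (\<exists>v\<in>set [0]. reach a n (a 0) v))"
        by (rule search_loop[OF c(1) a_ge]) (use that arr bottom in auto)
      then show "leads prog (29, ?R, ?M) ((8 * n + 9) * (sum_list (map (pops c n (a 0)) [0]) + 1)) ?Q"
        using reach_iff_exact_cover[of cs n c a] cs0 c a_def by (simp add: c_def)
    qed simp
  qed
  have read: "leads prog (7, R, M)
      (5 + 12 * L + (5 + (8 * n + 9) * (sum_list (map (pops c n (a 0)) [0]) + 1))) ?Q"
    if R: "R 2 = ?D" "R 9 = 1" "R 0 = 0" for R
  proof -
    let ?R = "R(11 := ?m, 3 := 1, 4 := ?D + 1, 5 := 2)"
    have "(step prog ^^ 4) (7, R, M) = (11, ?R, M)"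
      using R M01 by (simp add: run)
    then show ?thesis
    proof (rule leads_steps)
      show "leads prog (11, ?R, M)
        ((12 * length ?ys + 1) + (5 + (8 * n + 9) * (sum_list (map (pops c n (a 0)) [0]) + 1))) ?Q"
      proof (rule leads_trans[OF read_loop])
        fix c' :: config
        assume c': "case c' of (pc, R', M') \<Rightarrow> pc = 24 \<and> R' 2 = ?R 2 \<and> R' 9 = 1 \<and> R' 0 = ?R 0 \<and>
          M' = add_tot (?R 2) ?ys (?R 4) (?R 3) M"
        obtain R' where R': "c' = (24, R', add_tot ?D ?ys (?D + 1) 1 M)"
          "R' 2 = ?D" "R' 9 = 1" "R' 0 = 0"
          using c' R by (cases c') auto
        show "leads prog c' (5 + (8 * n + 9) * (sum_list (map (pops c n (a 0)) [0]) + 1)) ?Q"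
          unfolding R'(1) using R'(2-) by (rule finish)
      next
        fix j
        assume "j < length ?ys"
        then show "M (?R 5 + j) = ?ys ! j"
          using Mys[of j] len(1) by simp
      qed (use R count last len in \<open>simp_all\<close>)
    qed (use len(1) in simp)
  qed
  have "leads prog (3, (\<lambda>_. 0)(9 := 1, 11 := ?m, 2 := 8), M)
    ((4 * ?m + 1) + (5 + 12 * L + (5 + (8 * n + 9) * (sum_list (map (pops c n (a 0)) [0]) + 1)))) ?Q"
  proof (rule leads_trans)
    show "leads prog (3, (\<lambda>_. 0)(9 := 1, 11 := ?m, 2 := 8), M) (4 * ?m + 1)
      (\<lambda>(pc, R', M'). pc = 7 \<and> R' 2 = ?D \<and> R' 9 = 1 \<and> R' 0 = 0 \<and> M' = M)"
      using power_loop[of "(\<lambda>_. 0)(9 := 1, 11 := ?m, 2 := 8)" M] by simp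
  next
    fix c' :: config
    assume c': "case c' of (pc, R', M') \<Rightarrow> pc = 7 \<and> R' 2 = ?D \<and> R' 9 = 1 \<and> R' 0 = 0 \<and> M' = M"
    obtain R' where R': "c' = (7, R', M)" "R' 2 = ?D" "R' 9 = 1" "R' 0 = 0"
      using c' by (cases c') auto
    show "leads prog c'
      (5 + 12 * L + (5 + (8 * n + 9) * (sum_list (map (pops c n (a 0)) [0]) + 1))) ?Q"
      unfolding R'(1) using R'(2-) by (rule read)
  qed
  then show ?thesis
    by (rule leads_steps[OF start]) (use bound in simp)
qed

section \<open>Counting clauses\<close>

lemma finite_vars: "monotone_cnf F \<Longrightarrow> finite (vars F)"
  by (auto simp: monotone_cnf_def vars_def)

text \<open>Double counting of the pairs of a variable and a clause containing it.\<close>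

lemma regular_uniform_card:
  assumes "monotone_cnf F" "uniform_cnf k F" "regular_cnf l F"
  shows "card (vars F) * l = card F * k"
proof -
  have "(\<Sum>C\<in>F. card {x \<in> vars F. x \<in> C}) = (\<Sum>x\<in>vars F. l)"
    using assms by (intro sum_multicount_gen finite_vars) (auto simp: monotone_cnf_def regular_cnf_def)
  moreover have "card {x \<in> vars F. x \<in> C} = k" if "C \<in> F" for C
  proof -
    have "{x \<in> vars F. x \<in> C} = C"
      using that by (auto simp: vars_def)
    then show ?thesis
      using assms(2) that by (simp add: uniform_cnf_def)
  qed
  ultimately show ?thesis
    by simp
qed

text \<open>The other clauses meeting \<open>C\<close> are sorted by the variable they share with
  \<open>C\<close>. Linearity makes these \<open>k\<close> classes disjoint, and regularity gives
  each of them \<open>l - 1\<close> clauses.\<close>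

lemma card_linear_regular:
  assumes F: "monotone_cnf F" "linear_cnf F" "uniform_cnf k F" "regular_cnf l F" and C: "C \<in> F"
  shows "card F = 1 + k * (l - 1) + card {C' \<in> F. C' \<noteq> C \<and> unconnected C C'}"
proof -
  let ?N = "\<lambda>x. {C' \<in> F. x \<in> C'} - {C}"
  let ?U = "{C' \<in> F. C' \<noteq> C \<and> unconnected C C'}"
  have fin: "finite F" "finite C"
    using F(1) C by (auto simp: monotone_cnf_def)
  have card_N: "card (?N x) = l - 1" if "x \<in> C" for x
  proof -
    have "x \<in> vars F"
      using that C by (auto simp: vars_def)
    then have "card {C' \<in> F. x \<in> C'} = l"
      using F(4) by (simp add: regular_cnf_def)
    then show ?thesis
      using that C fin by (simp add: card_Diff_singleton)
  qed
  have disj: "?N x \<inter> ?N y = {}" if "x \<in> C" "y \<in> C" "x \<noteq> y" for x y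
  proof (rule ccontr)
    assume "?N x \<inter> ?N y \<noteq> {}"
    then obtain C' where C': "C' \<in> F" "C' \<noteq> C" "x \<in> C'" "y \<in> C'"
      by blast
    have "card {x, y} \<le> card (C \<inter> C')"
      using that C' fin(2) by (intro card_mono) auto
    also have "\<dots> \<le> 1"
      using F(2) C C'(1,2) unfolding linear_cnf_def by metis
    finally show False
      using that(3) by simp
  qed
  have "card (\<Union>x\<in>C. ?N x) = (\<Sum>x\<in>C. card (?N x))"
    using fin disj by (intro card_UN_disjoint) auto
  also have "\<dots> = k * (l - 1)"
    using card_N F(3) C by (simp add: uniform_cnf_def)
  finally have N: "card (\<Union>x\<in>C. ?N x) = k * (l - 1)" .
  have "F = insert C ((\<Union>x\<in>C. ?N x) \<union> ?U)"
    using C by (auto simp: unconnected_def)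
  then have "card F = card (insert C ((\<Union>x\<in>C. ?N x) \<union> ?U))"
    by (rule arg_cong)
  also have "\<dots> = 1 + card ((\<Union>x\<in>C. ?N x) \<union> ?U)"
    using fin by (subst card_insert_disjoint) auto
  also have "card ((\<Union>x\<in>C. ?N x) \<union> ?U) = card (\<Union>x\<in>C. ?N x) + card ?U"
    using fin by (intro card_Un_disjoint) (auto simp: unconnected_def)
  finally show ?thesis
    using N by simp
qed

text \<open>With at most one variable, all non-empty clauses would coincide. The bound
  \<open>2 \<le> n\<close> is what later gives \<open>n + 1 \<le> n * n\<close>.\<close>

lemma card_vars_ge_2:
  assumes "monotone_cnf F" "2 \<le> card F"
  shows "2 \<le> card (vars F)"
proof (rule ccontr)
  assume "\<not> 2 \<le> card (vars F)"
  then have "C = vars F" if "C \<in> F" for C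
  proof -
    have "C \<subseteq> vars F" "finite C" "C \<noteq> {}"
      using assms(1) that by (auto simp: vars_def monotone_cnf_def)
    moreover from this have "card C \<noteq> 0"
      by simp
    then have "card (vars F) \<le> card C"
      using \<open>\<not> 2 \<le> card (vars F)\<close> by linarith
    ultimately show ?thesis
      using card_seteq[OF finite_vars[OF assms(1)]] by blast
  qed
  then have "F \<subseteq> {vars F}"
    by blast
  then have "card F \<le> 1"
    using card_mono[of "{vars F}" F] by simp
  then show False
    using assms(2) by simp
qed

text \<open>\<open>X\<close> corresponds to the set of true variables, renamed by the numbering
  \<open>\<nu>\<close>.\<close>

lemma xsat_iff_exact_cover:
  assumes \<nu>: "bij_betw \<nu> (vars F) {1..n}" and cs: "set ` set cs = (\<lambda>C. \<nu> ` C) ` F"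
  shows "xsat F \<longleftrightarrow> (\<exists>X\<subseteq>{1..n}. \<forall>c\<in>set cs. card (X \<inter> set c) = 1)"
proof -
  have inj: "inj_on \<nu> (vars F)"
    using \<nu> by (rule bij_betw_imp_inj_on)
  have sub: "C \<subseteq> vars F" if "C \<in> F" for C
    using that by (auto simp: vars_def)
  have card: "card (X \<inter> \<nu> ` C) = card {y \<in> C. \<nu> y \<in> X}" if "C \<in> F" for X C
  proof -
    have "X \<inter> \<nu> ` C = \<nu> ` {y \<in> C. \<nu> y \<in> X}"
      by auto
    moreover have "inj_on \<nu> {y \<in> C. \<nu> y \<in> X}"
      using inj sub[OF that] by (auto intro: inj_on_subset)
    ultimately show ?thesis
      by (simp add: card_image)
  qed
  have "(\<forall>c\<in>set cs. card (X \<inter> set c) = 1) \<longleftrightarrow> (\<forall>D\<in>set ` set cs. card (X \<inter> D) = 1)" for X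
    by blast
  then have eq: "(\<forall>c\<in>set cs. card (X \<inter> set c) = 1) \<longleftrightarrow> (\<forall>C\<in>F. card {y \<in> C. \<nu> y \<in> X} = 1)" for X
    unfolding cs using card by simp
  show ?thesis
  proof
    assume "xsat F"
    then obtain \<tau> :: "nat \<Rightarrow> bool" where \<tau>: "\<forall>C\<in>F. card {y \<in> C. \<tau> y} = 1"
      unfolding xsat_def by blast
    let ?X = "\<nu> ` {y \<in> vars F. \<tau> y}"
    have "{y \<in> C. \<nu> y \<in> ?X} = {y \<in> C. \<tau> y}" if "C \<in> F" for C
      using sub[OF that] inj by (auto dest: inj_onD)
    then have "\<forall>C\<in>F. card {y \<in> C. \<nu> y \<in> ?X} = 1"
      using \<tau> by simp
    moreover have "?X \<subseteq> {1..n}"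
      using \<nu> by (auto simp: bij_betw_def)
    ultimately show "\<exists>X\<subseteq>{1..n}. \<forall>c\<in>set cs. card (X \<inter> set c) = 1"
      unfolding eq by blast
  next
    assume "\<exists>X\<subseteq>{1..n}. \<forall>c\<in>set cs. card (X \<inter> set c) = 1"
    then obtain X where "\<forall>C\<in>F. card {y \<in> C. \<nu> y \<in> X} = 1"
      unfolding eq by blast
    then show "xsat F"
      unfolding xsat_def by (intro exI[of _ "\<lambda>y. \<nu> y \<in> X"])
  qed
qed

lemma length_concat_terminated:
  "(\<And>c. c \<in> set cs \<Longrightarrow> length c = k) \<Longrightarrow>
   length (concat (map (\<lambda>c. c @ [0]) cs)) = length cs * (k + 1)"
  by (induction cs) auto

section \<open>Estimates\<close>

text \<open>Places the input, of length \<open>2 + m * (k + 1)\<close> with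
  \<open>k + 1 \<le> m\<close>, below the address \<open>8 * 2 ^ m\<close>.\<close>

lemma square_le_power2: "2 + m * m \<le> 8 * (2::nat) ^ m"
proof (induction m)
  case (Suc m)
  have "m < 2 ^ m"
    by (rule less_exp)
  then show ?case
    using Suc unfolding power_Suc mult_Suc mult_Suc_right by linarith
qed simp

text \<open>From \<open>k * k \<le> m * k = n * l \<le> n * l * l\<close> follows
  \<open>k \<le> l * sqrt n\<close>, and \<open>m\<close> is linear in \<open>k\<close> for fixed
  \<open>l\<close>.\<close>

lemma clauses_le_sqrt:
  fixes k l m n :: nat
  assumes "n * l = m * k" "k \<le> m" "m \<le> k * l + l * l" "1 \<le> n"
  shows "real m \<le> 2 * real l ^ 2 * sqrt (real n)"
proof -
  have "k * k \<le> n * l"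
    using assms(1,2) by simp
  also have "\<dots> \<le> n * (l * l)"
    by (cases l) auto
  finally have "real (k * k) \<le> real (n * (l * l))"
    by (simp only: of_nat_le_iff)
  then have "real k \<le> sqrt (real n * (real l)\<^sup>2)"
    by (intro real_le_rsqrt) (simp add: power2_eq_square)
  then have k: "real k \<le> real l * sqrt (real n)"
    by (simp add: real_sqrt_mult mult.commute)
  have "real m \<le> real k * real l + real l * real l"
    using assms(3) by (metis of_nat_add of_nat_le_iff of_nat_mult)
  also have "\<dots> \<le> (real l * sqrt (real n)) * real l + real l * real l * sqrt (real n)"
    using assms(4) mult_left_mono[of 1 "sqrt (real n)" "real l * real l"]
    by (intro add_mono mult_right_mono k) auto
  also have "\<dots> = 2 * real l ^ 2 * sqrt (real n)"
    by (simp add: power2_eq_square)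
  finally show ?thesis .
qed

text \<open>Uses \<open>n + 1 \<le> n * n\<close>, hence the factor 2 in the exponent.\<close>

lemma power_le_exp:
  fixes m n :: nat
  assumes "2 \<le> n" "real m \<le> b * sqrt (real n)"
  shows "(real n + 1) ^ m \<le> exp (2 * b * ln (real n) * sqrt (real n))"
proof -
  have "2 * real n \<le> real n * real n"
    using assms(1) by (intro mult_right_mono) auto
  then have "real n + 1 \<le> real n * real n"
    using assms(1) by linarith
  then have "(real n + 1) ^ m \<le> (real n * real n) ^ m"
    by (intro power_mono) auto
  also have "(real n * real n) ^ m = exp (2 * ln (real n) * real m)"
  proof -
    have "real n * real n = exp (2 * ln (real n))"
      unfolding mult_2 exp_add using assms(1) by simp
    then show ?thesis
      by (simp only: exp_of_nat2_mult)
  qed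
  also have "\<dots> \<le> exp (2 * ln (real n) * (b * sqrt (real n)))"
    using assms by (intro iffD2[OF exp_le_cancel_iff] mult_left_mono) auto
  finally show ?thesis
    by (simp add: mult_ac)
qed

text \<open>The coefficient 28 arises from \<open>4 * m \<le> 4 * n * l\<close> and
  \<open>12 * m * (k + 1) \<le> 24 * n * l\<close>. One factor \<open>n + 1\<close> of the power
  goes into the polynomial, where \<open>(n + 1) * E + E\<close> yields
  \<open>[:2, 1:]\<close>.\<close>

lemma steps_le:
  fixes k l m n t :: nat
  assumes nl: "n * l = m * k" and k: "1 \<le> k" and m: "k + 1 \<le> m" "m \<le> k * l + l * l" and n: "2 \<le> n"
    and t: "t \<le> 14 + 4 * m + 12 * (m * (k + 1)) + (8 * n + 9) * ((n + 1) ^ (m + 1) + 1)"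
  shows "real t \<le> poly ([:14, 28 * real l:] + [:9, 8:] * [:2, 1:]) (real n)
    * exp (4 * real l ^ 2 * ln (real n) * sqrt (real n))"
proof -
  define E where "E = exp (4 * real l ^ 2 * ln (real n) * sqrt (real n))"
  have E: "1 \<le> E"
    using n by (simp add: E_def)
  have "real m \<le> 2 * real l ^ 2 * sqrt (real n)"
    by (rule clauses_le_sqrt[OF nl _ m(2)]) (use m(1) n in auto)
  then have pow: "(real n + 1) ^ m \<le> E"
    using power_le_exp[OF n, of m "2 * real l ^ 2"] by (simp add: E_def)
  have "m \<le> n * l"
    unfolding nl using k by simp
  moreover have "m * (k + 1) = n * l + m"
    by (simp add: nl)
  ultimately have "t \<le> 14 + 28 * (n * l) + (8 * n + 9) * ((n + 1) ^ (m + 1) + 1)"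
    using t by linarith
  then have "real t \<le> real (14 + 28 * (n * l) + (8 * n + 9) * ((n + 1) ^ (m + 1) + 1))"
    by (simp only: of_nat_le_iff)
  also have "\<dots> = (14 + 28 * real l * real n) * 1
      + (8 * real n + 9) * ((real n + 1) * (real n + 1) ^ m + 1)"
    by (simp add: algebra_simps)
  also have "\<dots> \<le> (14 + 28 * real l * real n) * E + (8 * real n + 9) * ((real n + 1) * E + E)"
    using E pow by (intro add_mono mult_left_mono) auto
  also have "\<dots> = poly ([:14, 28 * real l:] + [:9, 8:] * [:2, 1:]) (real n) * E"
    by (simp add: algebra_simps)
  finally show ?thesis
    by (simp add: E_def)
qed

theorem theorem8:
  fixes l :: nat
  assumes "l \<ge> 1"
  shows "\<exists>(\<alpha>::real) (p::real poly) (P::program).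
    \<forall>(k::nat) (F::cnf) (w::nat list).
      k \<ge> 1 \<longrightarrow>
      monotone_cnf F \<longrightarrow>
      linear_cnf F \<longrightarrow>
      uniform_cnf k F \<longrightarrow>
      regular_cnf l F \<longrightarrow>
      (\<forall>C\<in>F. int (card {C' \<in> F. C' \<noteq> C \<and> unconnected C C'}) = int l * (int l - 2)) \<longrightarrow>
      presents w F \<longrightarrow>
      answers_within P w (xsat F)
        (poly p (real (card (vars F))) *
         exp (\<alpha> * ln (real (card (vars F))) * sqrt (real (card (vars F)))))"
proof (intro exI allI impI)
  fix k :: nat and F :: cnf and w :: "nat list"
  \<comment> \<open>The final \<open>show\<close> fixes the witnesses: \<open>\<alpha>\<close> is
    \<open>4 * real l ^ 2\<close>, the polynomial is \<open>?p\<close>, and \<open>prog\<close> is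
    the same program for all \<open>l\<close>.\<close>
  let ?p = "[:14, 28 * real l:] + [:9, 8:] * [:2, 1:]"
  let ?n = "card (vars F)" and ?m = "card F"
  assume k: "k \<ge> 1" and F: "monotone_cnf F" "linear_cnf F" "uniform_cnf k F" "regular_cnf l F"
    and unc: "\<forall>C\<in>F. int (card {C' \<in> F. C' \<noteq> C \<and> unconnected C C'}) = int l * (int l - 2)"
    and w: "presents w F"
  obtain C where C: "C \<in> F"
    using F(1) by (auto simp: monotone_cnf_def)
  let ?u = "card {C' \<in> F. C' \<noteq> C \<and> unconnected C C'}"
  have u: "int ?u = int l * (int l - 2)"
    using unc C by blast
  \<comment> \<open>A cardinality is non-negative, whereas \<open>l = 1\<close> would give
    -1.\<close>
  have "0 \<le> int l * (int l - 2)"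
    unfolding u[symmetric] by simp
  then have l: "2 \<le> l"
    using assms by (simp add: zero_le_mult_iff)
  have m: "?m = 1 + k * (l - 1) + ?u"
    by (rule card_linear_regular[OF F C])
  have "int ?u \<le> int (l * l)"
    unfolding u by (simp add: mult_left_mono)
  then have "?u \<le> l * l"
    by (simp only: of_nat_le_iff)
  moreover have "k * l = k * (l - 1) + k"
    using l by (simp add: algebra_simps)
  ultimately have m_le: "?m \<le> k * l + l * l"
    using m k by linarith
  have "k * 1 \<le> k * (l - 1)"
    using l by (intro mult_left_mono) auto
  then have m_ge: "k + 1 \<le> ?m"
    using m by linarith
  have nl: "?n * l = ?m * k"
    by (rule regular_uniform_card[OF F(1,3,4)])
  have n: "2 \<le> ?n"
    using m_ge k by (intro card_vars_ge_2[OF F(1)]) linarith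
  obtain \<nu> cs where \<nu>: "bij_betw \<nu> (vars F) {1..?n}" and cs: "\<And>c. c \<in> set cs \<Longrightarrow> distinct c"
    "distinct (map set cs)" "set ` set cs = (\<lambda>C. \<nu> ` C) ` F" and w_eq: "w = dimacs ?n cs"
    using w unfolding presents_def by blast
  have inj: "inj_on \<nu> (vars F)" and img: "\<nu> ` vars F = {1..?n}"
    using \<nu> by (auto simp: bij_betw_def)
  have sub: "D \<subseteq> vars F" if "D \<in> F" for D
    using that by (auto simp: vars_def)
  have len_c: "length c = k" if "c \<in> set cs" for c
  proof -
    have "set c \<in> (\<lambda>C. \<nu> ` C) ` F"
      unfolding cs(3)[symmetric] using that by (rule imageI)
    then obtain D where D: "D \<in> F" "set c = \<nu> ` D"
      by (elim imageE)
    have "length c = card (\<nu> ` D)"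
      unfolding D(2)[symmetric] by (rule distinct_card[OF cs(1)[OF that], symmetric])
    also have "\<dots> = card D"
      by (rule card_image[OF inj_on_subset[OF inj sub[OF D(1)]]])
    finally show ?thesis
      using F(3) D(1) by (simp add: uniform_cnf_def)
  qed
  have "inj_on (\<lambda>C. \<nu> ` C) F"
    using inj_on_image_eq_iff[OF inj] sub by (auto intro!: inj_onI)
  then have len: "length cs = ?m"
    using distinct_card[OF cs(2)] cs(3) by (simp add: card_image)
  have "\<Union> (set ` set cs) = \<nu> ` vars F"
    unfolding cs(3) vars_def by (rule image_Union[symmetric])
  then have vars: "\<Union> (set ` set cs) = {1..?n}"
    unfolding img .
  let ?L = "?m * (k + 1)"
  let ?T = "14 + 4 * ?m + 12 * ?L + (8 * ?n + 9) * ((?n + 1) ^ (?m + 1) + 1)"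
  let ?E = "exp (4 * real l ^ 2 * ln (real ?n) * sqrt (real ?n))"
  have L: "?L = length (concat (map (\<lambda>c. c @ [0]) cs))"
    unfolding len[symmetric] by (rule length_concat_terminated[symmetric, OF len_c])
  \<comment> \<open>Here \<open>k + 1 \<le> ?m\<close> bounds the input length by the number of
    clauses alone, which the machine knows before reading them.\<close>
  have "?L \<le> ?m * ?m"
    using m_ge by (intro mult_left_mono) auto
  then have "2 + ?L \<le> 2 + ?m * ?m"
    by (rule add_left_mono)
  then have "2 + ?L \<le> 8 * 2 ^ length cs"
    unfolding len using square_le_power2 by (rule order_trans)
  from prog_correct[OF cs(1) vars L this]
  have "leads prog (initial w) ?T (\<lambda>(pc, R, M). pc = 48 \<and> R 0 = of_bool (xsat F))"
    unfolding xsat_iff_exact_cover[OF \<nu> cs(3), symmetric] len w_eq .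
  then obtain t where "t \<le> ?T" and t: "(\<lambda>(pc, R, M). pc = 48 \<and> R 0 = of_bool (xsat F)) ((step prog ^^ t) (initial w))"
    by (rule leadsE)
  have time: "real t \<le> poly ?p (real ?n) * ?E"
    by (rule steps_le[OF nl k m_ge m_le n \<open>t \<le> ?T\<close>])
  obtain pc R M where run: "(step prog ^^ t) (initial w) = (pc, R, M)"
    by (rule prod_cases3)
  then have "halted prog (pc, R, M)" "R 0 = of_bool (xsat F)"
    using t by (simp_all only: halted_def length_prog split_conv fst_conv order_refl)
  with time run show "answers_within prog w (xsat F) (poly ?p (real ?n) * ?E)"
    unfolding answers_within_def by (intro exI conjI)
qed

end
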